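(* Let $k$ be a nonnegative integer and let $G$ be a $(2k)$-regular graph. Then the number of Eulerian orientations of $G$ is at least the number of spanning $k$-regular subgraphs of $G$. Equality holds if and only if $G$ is bipartite.
   Context: Graphs are finite and need not be connected. An Eulerian orientation of a graph with all degrees even is an orientation of its edges such that at each vertex the in-degree equals the out-degree. A spanning $k$-regular subgraph of $G$ is a subgraph $(V(G),A)$ with $A\subseteq E(G)$ in which every vertex of $G$ has degree exactly $k$. *)

theory Defs
  imports Main
begin

text \<open>
  Graphs are finite simple undirected graphs, given by a vertex set \<open>V\<close> and a set \<open>E\<close> of
  two-element subsets of \<open>V\<close>.
\<close>

definition simple_graph :: "'a set \<Rightarrow> 'a set set \<Rightarrow> bool" where
  "simple_graph V E \<longleftrightarrow> finite V \<and> (\<forall>e\<in>E. e \<subseteq> V \<and> card e = 2)"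

definition degree :: "'a set set \<Rightarrow> 'a \<Rightarrow> nat" where
  "degree E v = card {e \<in> E. v \<in> e}"

definition regular :: "nat \<Rightarrow> 'a set \<Rightarrow> 'a set set \<Rightarrow> bool" where
  "regular d V E \<longleftrightarrow> (\<forall>v\<in>V. degree E v = d)"

definition bipartite :: "'a set \<Rightarrow> 'a set set \<Rightarrow> bool" where
  "bipartite V E \<longleftrightarrow>
    (\<exists>X Y. X \<union> Y = V \<and> X \<inter> Y = {} \<and> (\<forall>e\<in>E. \<exists>x\<in>X. \<exists>y\<in>Y. e = {x, y}))"

text \<open>A spanning subgraph \<open>(V, A)\<close> is represented by its edge set \<open>A\<close>.\<close>

definition spanning_regular_subgraphs :: "nat \<Rightarrow> 'a set \<Rightarrow> 'a set set \<Rightarrow> 'a set set set" where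
  "spanning_regular_subgraphs k V E = {A. A \<subseteq> E \<and> regular k V A}"

text \<open>
  An orientation is a set \<open>D\<close> of arcs \<open>(tail, head)\<close> containing exactly one of the two
  directions of each edge and nothing else.
\<close>

definition orientation :: "'a set set \<Rightarrow> ('a \<times> 'a) set \<Rightarrow> bool" where
  "orientation E D \<longleftrightarrow>
    (\<forall>u v. (u, v) \<in> D \<longrightarrow> {u, v} \<in> E) \<and>
    (\<forall>u v. {u, v} \<in> E \<longrightarrow> ((u, v) \<in> D \<longleftrightarrow> (v, u) \<notin> D))"

definition in_degree :: "('a \<times> 'a) set \<Rightarrow> 'a \<Rightarrow> nat" where
  "in_degree D v = card {a \<in> D. snd a = v}"

definition out_degree :: "('a \<times> 'a) set \<Rightarrow> 'a \<Rightarrow> nat" where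
  "out_degree D v = card {a \<in> D. fst a = v}"

definition eulerian_orientations :: "'a set \<Rightarrow> 'a set set \<Rightarrow> ('a \<times> 'a) set set" where
  "eulerian_orientations V E =
    {D. orientation E D \<and> (\<forall>v\<in>V. in_degree D v = out_degree D v)}"

text \<open>Both families are finite, so that \<^const>\<open>card\<close> really counts their members.\<close>

lemma finite_spanning_regular_subgraphs:
  assumes "simple_graph V E"
  shows "finite (spanning_regular_subgraphs k V E)"
proof -
  have "E \<subseteq> Pow V" "finite V"
    using assms by (auto simp: simple_graph_def)
  then have "finite E"
    by (meson finite_Pow_iff finite_subset)
  moreover have "spanning_regular_subgraphs k V E \<subseteq> Pow E"
    by (auto simp: spanning_regular_subgraphs_def)
  ultimately show ?thesis
    by (meson finite_Pow_iff finite_subset)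
qed

lemma finite_eulerian_orientations:
  assumes "simple_graph V E"
  shows "finite (eulerian_orientations V E)"
proof -
  have "D \<subseteq> V \<times> V" if "D \<in> eulerian_orientations V E" for D
  proof
    fix a assume "a \<in> D"
    then have "{fst a, snd a} \<in> E"
      using that by (simp add: eulerian_orientations_def orientation_def)
    then have "{fst a, snd a} \<subseteq> V"
      using assms unfolding simple_graph_def by blast
    then show "a \<in> V \<times> V"
      by (simp add: mem_Times_iff)
  qed
  then have "eulerian_orientations V E \<subseteq> Pow (V \<times> V)"
    by blast
  moreover have "finite V"
    using assms by (simp add: simple_graph_def)
  ultimately show ?thesis
    by (meson finite_Pow_iff finite_SigmaI finite_subset)
qed

end

theory Submission
  imports "HOL-Computational_Algebra.Polynomial" "HOL-Library.FuncSet" Defs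
begin

text \<open>
  Choose \<open>k\<close> of the \<open>2k\<close> half-edges at every vertex. A spanning \<open>k\<close>-regular subgraph is a choice in
  which the two halves of each edge agree, an Eulerian orientation one in which they disagree. With
  signs \<open>\<sigma>\<close> on half-edges these conditions have indicators \<open>(1 + \<sigma>\<sigma>')/2\<close> and \<open>(1 - \<sigma>\<sigma>')/2\<close>. Expanding
  the product over the edges turns the two counts, up to the common factor \<open>2\<close> to the power
  \<open>card E\<close>, into sums of \<open>W(A)\<close> and of \<open>(-1)\<close> to the power \<open>card A\<close> times \<open>W(A)\<close> over the edge
  sets \<open>A\<close>, where \<open>W(A)\<close> is a product over the vertices of the coefficients of \<open>z\<close> to the power
  \<open>k\<close> in \<open>(1 - z)\<^sup>j (1 + z)\<^bsup>2k-j\<^esup>\<close> with \<open>j\<close> the degree of the vertex in \<open>A\<close>. This coefficient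
  vanishes for odd \<open>j\<close> and has the sign of \<open>(-1)\<^bsup>j/2\<^esup>\<close> for even \<open>j\<close>; hence, by the handshake
  lemma, the terms of the second sum are the absolute values of those of the first. The counts agree
  iff every edge set with all degrees even has even size, which characterises bipartite graphs.
\<close>

section \<open>Signed sums over subsets of fixed size\<close>

text \<open>A Krawtchouk polynomial value, the local factor at a vertex: \<open>B\<close> holds the
  edges there, \<open>J\<close> those in the expansion term, \<open>S\<close> the selected
  half-edges.\<close>

definition signed_subset_sum :: "'b set \<Rightarrow> 'b set \<Rightarrow> nat \<Rightarrow> int" where
  "signed_subset_sum B J k = (\<Sum>S | S \<subseteq> B \<and> card S = k. \<Prod>e\<in>J. if e \<in> S then -1 else 1)"

lemma prod_sign_inter:
  assumes "finite J"
  shows "(\<Prod>e\<in>J. if e \<in> S then -1 else 1 :: int) = (-1) ^ card (J \<inter> S)"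
  using assms by (simp add: prod.If_cases Int_def)

text \<open>Give each \<open>e\<close> the factor \<open>1 + c e * z\<close>, with sign -1 exactly
  on \<open>J\<close>; when the product over \<open>B\<close> is expanded, each subset
  \<open>S\<close> contributes its product of signs at \<open>z ^ card S\<close>.\<close>

lemma signed_subset_sum_coeff:
  assumes "finite B" "J \<subseteq> B"
  shows "signed_subset_sum B J k = coeff ([:1, -1:] ^ card J * [:1, 1:] ^ card (B - J)) k"
proof -
  define c :: "'a \<Rightarrow> int" where "c e = (if e \<in> J then -1 else 1)" for e
  have J: "finite J"
    using assms finite_subset by blast
  have monom: "(\<Prod>e\<in>S. monom (c e) 1) = monom (\<Prod>e\<in>S. c e) (card S)" if "finite S" for S
    using that by (induction rule: finite_induct) (simp_all add: mult_monom)
  have "(\<Prod>e\<in>B. monom (c e) 1 + 1) = (\<Prod>e\<in>J. monom (c e) 1 + 1) * (\<Prod>e\<in>B - J. monom (c e) 1 + 1)"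
    using assms by (metis mult.commute prod.subset_diff)
  also have "(\<Prod>e\<in>J. monom (c e) 1 + 1) = [:1, -1:] ^ card J"
    by (simp add: c_def one_pCons monom_altdef)
  also have "(\<Prod>e\<in>B - J. monom (c e) 1 + 1) = [:1, 1:] ^ card (B - J)"
    by (simp add: c_def one_pCons monom_altdef)
  finally have "coeff ([:1, -1:] ^ card J * [:1, 1:] ^ card (B - J)) k =
      coeff (\<Prod>e\<in>B. monom (c e) 1 + 1) k"
    by simp
  also have "\<dots> = (\<Sum>S\<in>Pow B. coeff (monom (\<Prod>e\<in>S. c e) (card S)) k)"
  proof -
    have "(\<Prod>e\<in>B. monom (c e) 1 + 1) = (\<Sum>S\<in>Pow B. \<Prod>e\<in>S. monom (c e) 1)"
      using prod_add[OF assms(1), of "\<lambda>e. monom (c e) 1" "\<lambda>_. 1"] by simp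
    also have "\<dots> = (\<Sum>S\<in>Pow B. monom (\<Prod>e\<in>S. c e) (card S))"
      using assms(1) by (intro sum.cong monom) (auto intro: finite_subset)
    finally show ?thesis
      by (simp add: coeff_sum)
  qed
  also have "\<dots> = (\<Sum>S | S \<subseteq> B \<and> card S = k. \<Prod>e\<in>S. c e)"
    using assms(1) by (intro sum.mono_neutral_cong_right) auto
  also have "\<dots> = signed_subset_sum B J k"
    unfolding signed_subset_sum_def
  proof (rule sum.cong)
    fix S assume "S \<in> {S. S \<subseteq> B \<and> card S = k}"
    then have "finite S"
      using assms(1) finite_subset by blast
    \<comment> \<open>Both products equal \<open>(-1) ^ card (J \<inter> S)\<close>.\<close>
    then show "(\<Prod>e\<in>S. c e) = (\<Prod>e\<in>J. if e \<in> S then -1 else 1)"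
      using prod_sign_inter[of S J] prod_sign_inter[OF J, of S] by (simp add: c_def Int_commute)
  qed simp
  finally show ?thesis
    by simp
qed

text \<open>Complementation in \<open>B\<close> preserves the size \<open>k\<close> and flips all
  \<open>card J\<close> signs, an odd number, so the sum equals its own negative.\<close>

lemma signed_subset_sum_odd:
  assumes "finite B" "J \<subseteq> B" "card B = 2 * k" "odd (card J)"
  shows "signed_subset_sum B J k = 0"
proof -
  have J: "finite J"
    using assms finite_subset by blast
  have "signed_subset_sum B J k =
      (\<Sum>S | S \<subseteq> B \<and> card S = k. - (\<Prod>e\<in>J. if e \<in> S then -1 else 1))"
    unfolding signed_subset_sum_def
  proof (rule sum.reindex_bij_witness[of _ "\<lambda>S. B - S" "\<lambda>S. B - S"])
    fix S assume "S \<in> {S. S \<subseteq> B \<and> card S = k}"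
    have "(\<Prod>e\<in>J. if e \<in> B - S then -1 else 1 :: int) = (\<Prod>e\<in>J. - (if e \<in> S then -1 else 1))"
      using assms(2) by (intro prod.cong) auto
    also have "\<dots> = - (\<Prod>e\<in>J. if e \<in> S then -1 else 1)"
      using assms(4) by (simp add: prod_uminus)
    finally show "- (\<Prod>e\<in>J. if e \<in> B - S then -1 else 1) =
        (\<Prod>e\<in>J. if e \<in> S then -1 else 1 :: int)"
      by simp
  qed (use assms in \<open>auto simp: card_Diff_subset finite_subset\<close>)
  then show ?thesis
    by (simp add: signed_subset_sum_def sum_negf)
qed

text \<open>The algebra of the induction step below: \<open>f\<close>, \<open>g\<close>,
  \<open>h\<close> stand for the factorials of \<open>i\<close>, \<open>l\<close>,
  \<open>i + l\<close>, \<open>x\<close> and \<open>y\<close> for those of \<open>2 * i\<close> and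
  \<open>2 * l\<close>, \<open>s\<close> for \<open>(-1) ^ i\<close>, and \<open>a\<close>,
  \<open>c\<close> for the coefficients at \<open>l + 1\<close> and \<open>l\<close>.\<close>

lemma super_catalan_recurrence:
  fixes a c f g h s x y i l :: int
  assumes "a * (f * ((l + 1) * g) * ((i + l + 1) * h)) = s * x * (2 * (l + 1) * (2 * l + 1) * y)"
    and "c * (f * g * h) = s * x * y"
    and "l + 1 \<noteq> 0"
  shows "(a - 4 * c) * ((i + 1) * f * g * ((i + l + 1) * h)) =
    -1 * s * (2 * (i + 1) * (2 * i + 1) * x) * y"
proof -
  have "(l + 1) * ((a - 4 * c) * ((i + 1) * f * g * ((i + l + 1) * h))) =
      (i + 1) * (a * (f * ((l + 1) * g) * ((i + l + 1) * h))) -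
      4 * (l + 1) * (i + 1) * (i + l + 1) * (c * (f * g * h))"
    by (simp add: algebra_simps)
  \<comment> \<open>Uses
    \<open>2 * (2 * l + 1) - 4 * (i + l + 1) = -2 * (2 * i + 1)\<close>.\<close>
  also have "\<dots> = (l + 1) * (-1 * s * (2 * (i + 1) * (2 * i + 1) * x) * y)"
    unfolding assms(1,2) by (simp add: algebra_simps)
  finally show ?thesis
    by (simp only: mult_left_cancel[OF assms(3)])
qed

text \<open>
  Up to sign these coefficients are the super Catalan numbers; the recurrence comes from
  \<open>(1 - z)\<^sup>2 = (1 + z)\<^sup>2 - 4z\<close>.
\<close>

lemma central_coeff_closed_form:
  "coeff ([:1, -1:] ^ (2 * i) * [:1, 1:] ^ (2 * l)) (i + l) * (fact i * fact l * fact (i + l)) =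
    (-1) ^ i * fact (2 * i) * (fact (2 * l) :: int)"
proof (induction i arbitrary: l)
  case 0
  have "coeff ([:1, 1::int:] ^ (2 * l)) l = int (2 * l choose l)"
    by (simp add: coeff_linear_poly_power)
  moreover have "int (2 * l choose l) * (fact l * fact l) = fact (2 * l)"
    using binomial_fact_lemma[of l "2 * l"]
    by (metis (no_types, lifting) diff_add_inverse2 le_add2 mult.commute mult_2 of_nat_fact of_nat_mult)
  ultimately show ?case
    by simp
next
  case (Suc i)
  define p :: "int poly" where "p = [:1, -1:] ^ (2 * i) * [:1, 1:] ^ (2 * l)"
  define a where "a = coeff ([:1, -1:] ^ (2 * i) * [:1, 1::int:] ^ (2 * Suc l)) (i + Suc l)"
  have "[:1, -1:] ^ (2 * Suc i) * [:1, 1:] ^ (2 * l) = p * [:1, -1:]^2"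
    unfolding p_def mult_Suc_right power_add by (simp only: mult_ac)
  also have "[:1, -1::int:]^2 = [:1, 1:]^2 - monom 4 1"
    by (simp add: power2_eq_square monom_altdef)
  also have "p * \<dots> = [:1, -1:] ^ (2 * i) * [:1, 1:] ^ (2 * Suc l) - monom 4 1 * p"
    unfolding p_def right_diff_distrib mult_Suc_right power_add by (simp only: mult_ac)
  \<comment> \<open>\<open>monom 4 1\<close> is \<open>4z\<close> and lowers the index to
    \<open>i + l\<close>, while \<open>Suc i + l = i + Suc l\<close> is the central index for
    \<open>a\<close>. The induction hypothesis thus applies at both \<open>Suc l\<close> and
    \<open>l\<close>.\<close>
  finally have "coeff ([:1, -1:] ^ (2 * Suc i) * [:1, 1:] ^ (2 * l)) (Suc i + l) =
      a - 4 * coeff p (i + l)"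
    by (simp add: a_def coeff_monom_mult)
  moreover have "a * (fact i * fact (Suc l) * fact (i + Suc l)) =
      (-1) ^ i * fact (2 * i) * fact (2 * Suc l)"
    unfolding a_def by (rule Suc.IH)
  moreover have "coeff p (i + l) * (fact i * fact l * fact (i + l)) =
      (-1) ^ i * fact (2 * i) * fact (2 * l)"
    unfolding p_def by (rule Suc.IH)
  moreover have "fact (2 * Suc l) = 2 * (int l + 1) * (2 * int l + 1) * fact (2 * l)"
    "fact (2 * Suc i) = 2 * (int i + 1) * (2 * int i + 1) * fact (2 * i)"
    by (simp_all add: algebra_simps)
  moreover have "fact (Suc l) = (int l + 1) * fact l" "fact (Suc i) = (int i + 1) * fact i"
    "fact (Suc i + l) = (int i + int l + 1) * fact (i + l)"
    "fact (i + Suc l) = (int i + int l + 1) * fact (i + l)"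
    by (simp_all add: algebra_simps)
  moreover have "int l + 1 \<noteq> 0"
    by simp
  ultimately show ?case
    by (simp only: power_Suc) (rule super_catalan_recurrence)
qed

text \<open>With \<open>card J = 2 * i\<close> and \<open>card (B - J) = 2 * l\<close>, the index
  \<open>k = i + l\<close> is central, and the closed form has sign \<open>(-1) ^ i\<close>.\<close>

lemma signed_subset_sum_even:
  assumes "finite B" "J \<subseteq> B" "card B = 2 * k" "even (card J)"
  shows "(-1) ^ (card J div 2) * signed_subset_sum B J k > 0"
proof -
  obtain i where i: "card J = 2 * i"
    using assms(4) by blast
  have "card J \<le> card B"
    by (rule card_mono[OF assms(1,2)])
  then obtain l where l: "k = i + l"
    using i assms(3) by (metis mult_le_cancel1 nat_le_iff_add zero_less_numeral)
  then have "card (B - J) = 2 * l"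
    using assms i by (simp add: card_Diff_subset finite_subset)
  then have "signed_subset_sum B J k * (fact i * fact l * fact (i + l)) =
      (-1) ^ i * fact (2 * i) * fact (2 * l)"
    using central_coeff_closed_form[of i l] signed_subset_sum_coeff[OF assms(1,2), of k] i l by simp
  then have "((-1) ^ i * signed_subset_sum B J k) * (fact i * fact l * fact (i + l)) =
      fact (2 * i) * fact (2 * l)"
    by (simp add: mult.assoc flip: power_mult_distrib)
  then have "0 < ((-1) ^ i * signed_subset_sum B J k) * (fact i * fact l * fact (i + l))"
    by simp
  moreover have "(0::int) < fact i * fact l * fact (i + l)"
    by simp
  ultimately have "0 < (-1) ^ i * signed_subset_sum B J k"
    by (rule zero_less_mult_pos2)
  then show ?thesis
    using i by simp
qed

section \<open>Half-edge configurations\<close>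

definition incident :: "'a set set \<Rightarrow> 'a \<Rightarrow> 'a set set" where
  "incident E v = {e \<in> E. v \<in> e}"

text \<open>The half-edge of \<open>e\<close> at \<open>v\<close> is selected by a configuration \<open>g\<close> iff \<open>e \<in> g v\<close>.\<close>

definition half_edge_configs :: "nat \<Rightarrow> 'a set \<Rightarrow> 'a set set \<Rightarrow> ('a \<Rightarrow> 'a set set) set" where
  "half_edge_configs k V E = (\<Pi>\<^sub>E v\<in>V. {S. S \<subseteq> incident E v \<and> card S = k})"

text \<open>A selected half-edge carries the sign -1, so on a two-element edge this records whether
  its halves agree.\<close>

definition edge_sign :: "('a \<Rightarrow> 'a set set) \<Rightarrow> 'a set \<Rightarrow> int" where
  "edge_sign g e = (\<Prod>v\<in>e. if e \<in> g v then -1 else 1)"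

lemma edge_sign_doubleton:
  "u \<noteq> v \<Longrightarrow> edge_sign g {u, v} = (if {u, v} \<in> g u \<longleftrightarrow> {u, v} \<in> g v then 1 else -1)"
  by (simp add: edge_sign_def)

section \<open>Elementary facts on edges and incidence\<close>

lemma simple_graph_finite_edges:
  assumes "simple_graph V E"
  shows "finite E"
proof (rule finite_subset)
  show "E \<subseteq> Pow V"
    using assms by (auto simp: simple_graph_def)
qed (use assms in \<open>simp add: simple_graph_def\<close>)

lemma simple_graph_edgeE:
  assumes "simple_graph V E" "e \<in> E"
  obtains u v where "e = {u, v}" "u \<noteq> v" "u \<in> V" "v \<in> V"
proof -
  have "card e = 2" "e \<subseteq> V"
    using assms by (auto simp: simple_graph_def)
  then show ?thesis
    using that by (auto simp: card_2_iff)
qed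

lemma simple_graph_arc:
  assumes "simple_graph V E" "{u, v} \<in> E"
  shows "u \<noteq> v" "u \<in> V"
  using simple_graph_edgeE[OF assms] by (auto simp: doubleton_eq_iff)

lemma card_incident: "card (incident E v) = degree E v"
  by (simp add: incident_def degree_def)

lemma finite_incident: "finite E \<Longrightarrow> finite (incident E v)"
  by (simp add: incident_def)

lemma incident_mono: "A \<subseteq> E \<Longrightarrow> incident A v \<subseteq> incident E v"
  by (auto simp: incident_def)

lemma edge_sign_cases:
  assumes "simple_graph V E" "e \<in> E"
  shows "edge_sign g e = 1 \<or> edge_sign g e = -1"
  by (cases rule: simple_graph_edgeE[OF assms]) (simp add: edge_sign_doubleton)

lemma finite_half_edge_configs:
  assumes "simple_graph V E"
  shows "finite (half_edge_configs k V E)"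
  unfolding half_edge_configs_def
proof (rule finite_PiE)
  show "finite V"
    using assms by (simp add: simple_graph_def)
  show "finite {S. S \<subseteq> incident E v \<and> card S = k}" for v
    using simple_graph_finite_edges[OF assms] by (simp add: finite_incident)
qed

lemma card_spanning_regular_subgraphs:
  assumes "simple_graph V E"
  shows "card (spanning_regular_subgraphs k V E) =
    card {g \<in> half_edge_configs k V E. \<forall>e\<in>E. edge_sign g e = 1}"
proof -
  \<comment> \<open>\<open>?f\<close> selects both halves of each edge of \<open>A\<close>;
    \<open>restrict\<close> supplies the value \<open>undefined\<close> off \<open>V\<close> that
    \<open>PiE\<close> demands.\<close>
  let ?f = "\<lambda>A. restrict (incident A) V" and ?h = "\<lambda>g. {e \<in> E. \<forall>v\<in>e. e \<in> g v}"
  let ?C = "{g \<in> half_edge_configs k V E. \<forall>e\<in>E. edge_sign g e = 1}"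
  have sub: "e \<subseteq> V" if "e \<in> E" for e
    using assms that by (auto simp: simple_graph_def)
  \<comment> \<open>Sign 1 means that an edge selected at one end is selected at the other, so
    \<open>?h\<close> loses no selected half-edge.\<close>
  have hf: "incident (?h g) v = g v" if g: "g \<in> ?C" and v: "v \<in> V" for g v
  proof -
    have gv: "g v \<subseteq> incident E v"
      using g v by (auto simp: half_edge_configs_def)
    have "e \<in> g w" if "e \<in> g v" "w \<in> e" for e w
    proof -
      have e: "e \<in> E" "v \<in> e"
        using gv that by (auto simp: incident_def)
      then obtain x y where xy: "e = {x, y}" "x \<noteq> y"
        using simple_graph_edgeE[OF assms] by metis
      have "edge_sign g e = 1"
        using g e by blast
      then have "e \<in> g x \<longleftrightarrow> e \<in> g y"
        using xy edge_sign_doubleton[of x y g] by (auto split: if_splits)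
      then show ?thesis
        using xy e that by auto
    qed
    then show ?thesis
      using gv by (auto simp: incident_def)
  qed
  have "\<forall>A\<in>spanning_regular_subgraphs k V E. ?h (?f A) = A"
  proof
    fix A assume "A \<in> spanning_regular_subgraphs k V E"
    then have A: "A \<subseteq> E"
      by (simp add: spanning_regular_subgraphs_def)
    \<comment> \<open>An empty edge would satisfy the condition in \<open>?h\<close>
      vacuously.\<close>
    have "e \<noteq> {}" if "e \<in> E" for e
      using simple_graph_edgeE[OF assms that] by blast
    then show "?h (?f A) = A"
      using A sub by (fastforce simp: incident_def restrict_def)
  qed
  moreover have "\<forall>g\<in>?C. ?f (?h g) = g"
  proof
    fix g assume g: "g \<in> ?C"
    then have "g \<in> extensional V"
      by (auto simp: half_edge_configs_def PiE_def)
    then show "?f (?h g) = g"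
      using hf[OF g] by (auto simp: restrict_def extensional_def fun_eq_iff)
  qed
  moreover have "?f ` spanning_regular_subgraphs k V E \<subseteq> ?C"
  proof
    fix g assume "g \<in> ?f ` spanning_regular_subgraphs k V E"
    then obtain A where A: "A \<subseteq> E" "\<forall>v\<in>V. degree A v = k" and g: "g = ?f A"
      by (auto simp: spanning_regular_subgraphs_def regular_def)
    have "g \<in> half_edge_configs k V E"
      using A g by (auto simp: half_edge_configs_def card_incident) (auto simp: incident_def)
    moreover have "edge_sign g e = 1" if e: "e \<in> E" for e
    proof -
      obtain u v where "e = {u, v}" "u \<noteq> v" "u \<in> V" "v \<in> V"
        using simple_graph_edgeE[OF assms e] .
      then show ?thesis
        using g by (simp add: edge_sign_doubleton incident_def)
    qed
    ultimately show "g \<in> ?C"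
      by blast
  qed
  moreover have "?h ` ?C \<subseteq> spanning_regular_subgraphs k V E"
  proof
    fix A assume "A \<in> ?h ` ?C"
    then obtain g where g: "g \<in> ?C" and A: "A = ?h g"
      by blast
    have "degree A v = k" if "v \<in> V" for v
      using hf[OF g that] g that by (auto simp: A half_edge_configs_def simp flip: card_incident)
    then show "A \<in> spanning_regular_subgraphs k V E"
      by (auto simp: spanning_regular_subgraphs_def regular_def A)
  qed
  ultimately have "bij_betw ?f (spanning_regular_subgraphs k V E) ?C"
    by (intro bij_betw_byWitness[where f' = ?h])
  then show ?thesis
    by (rule bij_betw_same_card)
qed

section \<open>Eulerian orientations as half-edge configurations\<close>

definition out_edges :: "('a \<times> 'a) set \<Rightarrow> 'a \<Rightarrow> 'a set set" where
  "out_edges D v = {{v, w} |w. (v, w) \<in> D}"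

lemma card_out_edges: "card (out_edges D v) = out_degree D v"
proof -
  have "out_edges D v = (\<lambda>a. {v, snd a}) ` {a \<in> D. fst a = v}"
    by (force simp: out_edges_def)
  moreover have "inj_on (\<lambda>a. {v, snd a}) {a \<in> D. fst a = v}"
    by (rule inj_onI) (auto simp: doubleton_eq_iff prod_eq_iff)
  ultimately show ?thesis
    by (simp add: out_degree_def card_image)
qed

lemma card_in_edges: "card {{w, v} |w. (w, v) \<in> D} = in_degree D v"
proof -
  have "{{w, v} |w. (w, v) \<in> D} = (\<lambda>a. {fst a, v}) ` {a \<in> D. snd a = v}"
    by force
  moreover have "inj_on (\<lambda>a. {fst a, v}) {a \<in> D. snd a = v}"
    by (rule inj_onI) (auto simp: doubleton_eq_iff prod_eq_iff)
  ultimately show ?thesis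
    by (simp add: in_degree_def card_image)
qed

text \<open>Incoming and outgoing edges partition the edges at \<open>v\<close>. In a
  \<open>2 * k\<close>-regular graph, balance at a vertex therefore amounts to out-degree
  \<open>k\<close>.\<close>

lemma orientation_degree_sum:
  assumes G: "simple_graph V E" and D: "orientation E D"
  shows "in_degree D v + out_degree D v = degree E v"
proof -
  let ?I = "{{w, v} |w. (w, v) \<in> D}"
  have arc: "{u, w} \<in> E" if "(u, w) \<in> D" for u w
    using D that by (auto simp: orientation_def)
  have anti: "(w, u) \<notin> D" if "(u, w) \<in> D" for u w
    using D that arc[OF that] by (auto simp: orientation_def)
  have total: "(u, w) \<in> D \<or> (w, u) \<in> D" if "{u, w} \<in> E" for u w
    using D that by (auto simp: orientation_def)
  have "incident E v = ?I \<union> out_edges D v"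
  proof (intro equalityI subsetI)
    fix e assume "e \<in> incident E v"
    then have "e \<in> E" "v \<in> e"
      by (auto simp: incident_def)
    then obtain w where "e = {v, w}"
      using simple_graph_edgeE[OF G] by (metis doubleton_eq_iff insertE singletonD)
    then show "e \<in> ?I \<union> out_edges D v"
      using total[of v w] \<open>e \<in> E\<close> by (auto simp: out_edges_def)
  next
    fix e assume "e \<in> ?I \<union> out_edges D v"
    then show "e \<in> incident E v"
      using arc by (auto simp: incident_def out_edges_def)
  qed
  moreover have "?I \<inter> out_edges D v = {}"
    by (auto simp: out_edges_def doubleton_eq_iff dest: anti)
  moreover have "finite (incident E v)"
    using simple_graph_finite_edges[OF G] by (simp add: finite_incident)
  ultimately have "card (incident E v) = card ?I + card (out_edges D v)"
    by (simp add: card_Un_disjoint)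
  then show ?thesis
    by (simp add: card_incident card_in_edges card_out_edges)
qed

lemma card_eulerian_orientations:
  assumes G: "simple_graph V E" and R: "regular (2 * k) V E"
  shows "card (eulerian_orientations V E) =
    card {g \<in> half_edge_configs k V E. \<forall>e\<in>E. edge_sign g e = -1}"
proof -
  \<comment> \<open>\<open>?f\<close> selects the half of each edge at its tail; \<open>?h\<close>
    directs an edge away from its selected half. Exactly one half is selected iff the sign is
    -1.\<close>
  let ?f = "\<lambda>D. restrict (out_edges D) V" and ?h = "\<lambda>g. {(u, w). {u, w} \<in> E \<and> {u, w} \<in> g u}"
  let ?C = "{g \<in> half_edge_configs k V E. \<forall>e\<in>E. edge_sign g e = -1}"
  have arc: "{u, w} \<in> E" if "(u, w) \<in> D" "orientation E D" for u w D
    using that by (auto simp: orientation_def)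
  have out_iff: "{u, w} \<in> out_edges D u \<longleftrightarrow> (u, w) \<in> D" for D u w
    by (auto simp: out_edges_def doubleton_eq_iff)
  have hf: "out_edges (?h g) v = g v" if g: "g \<in> ?C" and v: "v \<in> V" for g v
  proof -
    have gv: "g v \<subseteq> incident E v"
      using g v by (auto simp: half_edge_configs_def)
    show ?thesis
    proof (intro equalityI subsetI)
      fix e assume e: "e \<in> g v"
      then have "e \<in> E" "v \<in> e"
        using gv by (auto simp: incident_def)
      then obtain w where "e = {v, w}"
        using simple_graph_edgeE[OF G] by (metis doubleton_eq_iff insertE singletonD)
      then show "e \<in> out_edges (?h g) v"
        using e \<open>e \<in> E\<close> by (auto simp: out_edges_def)
    qed (auto simp: out_edges_def)
  qed
  have ori: "orientation E (?h g)" if g: "g \<in> ?C" for g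
    unfolding orientation_def
  proof (intro conjI allI impI)
    fix u w assume e: "{u, w} \<in> E"
    then have "edge_sign g {u, w} = -1" "u \<noteq> w"
      using g simple_graph_arc[OF G e] by auto
    then show "(u, w) \<in> ?h g \<longleftrightarrow> (w, u) \<notin> ?h g"
      using e by (auto simp: edge_sign_doubleton insert_commute split: if_splits)
  qed auto
  have "\<forall>D\<in>eulerian_orientations V E. ?h (?f D) = D"
  proof
    fix D assume "D \<in> eulerian_orientations V E"
    then have D: "orientation E D"
      by (simp add: eulerian_orientations_def)
    have "u \<in> V" if "{u, w} \<in> E" for u w
      using simple_graph_arc(2)[OF G that] .
    moreover from this have "u \<in> V" if "(u, w) \<in> D" for u w
      using arc[OF that D] .
    ultimately show "?h (?f D) = D"
      using arc[OF _ D] by (auto simp: out_iff restrict_def split: if_splits)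
  qed
  moreover have "\<forall>g\<in>?C. ?f (?h g) = g"
  proof
    fix g assume g: "g \<in> ?C"
    then have "g \<in> extensional V"
      by (auto simp: half_edge_configs_def PiE_def)
    then show "?f (?h g) = g"
      using hf[OF g] by (auto simp: restrict_def extensional_def fun_eq_iff)
  qed
  moreover have "?f ` eulerian_orientations V E \<subseteq> ?C"
  proof
    fix g assume "g \<in> ?f ` eulerian_orientations V E"
    then obtain D where D: "orientation E D" "\<forall>v\<in>V. in_degree D v = out_degree D v"
      and g: "g = ?f D"
      by (auto simp: eulerian_orientations_def)
    have "out_degree D v = k" if "v \<in> V" for v
      using orientation_degree_sum[OF G D(1), of v] D(2) R that by (auto simp: regular_def)
    moreover have "out_edges D v \<subseteq> incident E v" for v
      using arc[OF _ D(1)] by (auto simp: out_edges_def incident_def)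
    ultimately have "g \<in> half_edge_configs k V E"
      by (simp add: g half_edge_configs_def card_out_edges)
    moreover have "edge_sign g e = -1" if e: "e \<in> E" for e
    proof -
      obtain u v where uv: "e = {u, v}" "u \<noteq> v" "u \<in> V" "v \<in> V"
        using simple_graph_edgeE[OF G e] .
      then have "(u, v) \<in> D \<longleftrightarrow> (v, u) \<notin> D"
        using D(1) e by (auto simp: orientation_def)
      moreover have "{u, v} \<in> out_edges D v \<longleftrightarrow> (v, u) \<in> D"
        using out_iff[of v u D] by (simp add: insert_commute)
      ultimately show ?thesis
        using g uv by (simp add: edge_sign_doubleton out_iff)
    qed
    ultimately show "g \<in> ?C"
      by blast
  qed
  moreover have "?h ` ?C \<subseteq> eulerian_orientations V E"
  proof
    fix D assume "D \<in> ?h ` ?C"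
    then obtain g where g: "g \<in> ?C" and D: "D = ?h g"
      by blast
    have oD: "orientation E D"
      using ori[OF g] D by simp
    have "in_degree D v = out_degree D v" if v: "v \<in> V" for v
    proof -
      have "card (g v) = k"
        using g v by (auto simp: half_edge_configs_def)
      then have "out_degree D v = k"
        using hf[OF g v] D card_out_edges[of D v] by simp
      then show ?thesis
        using orientation_degree_sum[OF G oD, of v] R v by (auto simp: regular_def)
    qed
    then show "D \<in> eulerian_orientations V E"
      using oD by (simp add: eulerian_orientations_def)
  qed
  ultimately have "bij_betw ?f (eulerian_orientations V E) ?C"
    by (intro bij_betw_byWitness[where f' = ?h])
  then show ?thesis
    by (rule bij_betw_same_card)
qed

section \<open>Expansion over edge subsets\<close>

text \<open>For \<open>A \<subseteq> E\<close> this is the sum, over all configurations, of the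
  product of the signs of the edges in \<open>A\<close>, factored over the vertices.\<close>

definition edge_weight :: "nat \<Rightarrow> 'a set \<Rightarrow> 'a set set \<Rightarrow> 'a set set \<Rightarrow> int" where
  "edge_weight k V E A = (\<Prod>v\<in>V. signed_subset_sum (incident E v) (incident A v) k)"

lemma prod_incidences:
  fixes F :: "'a \<Rightarrow> 'a set \<Rightarrow> 'b :: comm_monoid_mult"
  assumes "finite V" "finite A" "\<And>e. e \<in> A \<Longrightarrow> e \<subseteq> V"
  shows "(\<Prod>e\<in>A. \<Prod>v\<in>e. F v e) = (\<Prod>v\<in>V. \<Prod>e\<in>incident A v. F v e)"
proof -
  have "(\<Prod>e\<in>A. \<Prod>v\<in>e. F v e) = (\<Prod>e\<in>A. \<Prod>v\<in>{v \<in> V. v \<in> e}. F v e)"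
    using assms(3) by (intro prod.cong) auto
  also have "\<dots> = (\<Prod>v\<in>V. \<Prod>e\<in>{e \<in> A. v \<in> e}. F v e)"
    using assms by (intro prod.swap_restrict)
  finally show ?thesis
    by (simp add: incident_def)
qed

lemma handshake:
  assumes G: "simple_graph V E" and A: "A \<subseteq> E"
  shows "(\<Sum>v\<in>V. degree A v) = 2 * card A"
proof -
  have fA: "finite A" and fV: "finite V"
    using simple_graph_finite_edges[OF G] A G finite_subset by (auto simp: simple_graph_def)
  have "(\<Sum>v\<in>V. degree A v) = (\<Sum>v\<in>V. \<Sum>e\<in>{e \<in> A. v \<in> e}. 1)"
    by (simp add: degree_def)
  also have "\<dots> = (\<Sum>e\<in>A. \<Sum>v\<in>{v \<in> V. v \<in> e}. 1)"
    using fA fV by (intro sum.swap_restrict)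
  also have "\<dots> = (\<Sum>e\<in>A. 2)"
  proof (rule sum.cong)
    fix e assume "e \<in> A"
    then have "e \<subseteq> V" "card e = 2"
      using G A by (auto simp: simple_graph_def)
    moreover from this have "{v \<in> V. v \<in> e} = e"
      by blast
    ultimately show "(\<Sum>v\<in>{v \<in> V. v \<in> e}. 1) = (2::nat)"
      by simp
  qed simp
  finally show ?thesis
    by simp
qed

text \<open>The factor \<open>s * edge_sign g e + 1\<close> is 2 if the sign is \<open>s\<close> and
  0 otherwise, so the product over \<open>E\<close> is a scaled indicator; it is then expanded over
  subsets of \<open>E\<close>.\<close>

lemma sum_edge_sign_expansion:
  fixes s :: int
  assumes G: "simple_graph V E" and s: "s = 1 \<or> s = -1"
  shows "2 ^ card E * int (card {g \<in> half_edge_configs k V E. \<forall>e\<in>E. edge_sign g e = s}) =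
    (\<Sum>A\<in>Pow E. s ^ card A * edge_weight k V E A)"
proof -
  let ?C = "half_edge_configs k V E"
  have fE: "finite E" and fV: "finite V"
    using simple_graph_finite_edges[OF G] G by (auto simp: simple_graph_def)
  have fC: "finite ?C"
    using finite_half_edge_configs[OF G] .
  have ind: "(\<Prod>e\<in>E. s * edge_sign g e + 1) =
      (if \<forall>e\<in>E. edge_sign g e = s then 2 ^ card E else 0)" for g
  proof (cases "\<forall>e\<in>E. edge_sign g e = s")
    case True
    then have "(\<Prod>e\<in>E. s * edge_sign g e + 1) = (\<Prod>e\<in>E. 2)"
      using s by (intro prod.cong) auto
    then show ?thesis
      using True by simp
  next
    case False
    then obtain e where e: "e \<in> E" "edge_sign g e \<noteq> s"
      by blast
    then have "s * edge_sign g e + 1 = 0"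
      using edge_sign_cases[OF G e(1), of g] s by auto
    then have "(\<Prod>e\<in>E. s * edge_sign g e + 1) = 0"
      using e fE by (intro prod_zero) auto
    then show ?thesis
      by (simp only: False if_False)
  qed
  have sumA: "(\<Sum>g\<in>?C. \<Prod>e\<in>A. edge_sign g e) = edge_weight k V E A" if A: "A \<subseteq> E" for A
  proof -
    have fA: "finite A"
      using A fE finite_subset by blast
    have "(\<Prod>e\<in>A. edge_sign g e) =
        (\<Prod>v\<in>V. \<Prod>e\<in>incident A v. if e \<in> g v then -1 else 1)" for g
      unfolding edge_sign_def using fA fV G A
      by (intro prod_incidences) (auto simp: simple_graph_def)
    then have "(\<Sum>g\<in>?C. \<Prod>e\<in>A. edge_sign g e) =
        (\<Sum>g\<in>?C. \<Prod>v\<in>V. \<Prod>e\<in>incident A v. if e \<in> g v then -1 else 1)"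
      by simp
    \<comment> \<open>Choices at different vertices are independent, so the sum of products factors
      into a product of sums.\<close>
    also have "\<dots> = edge_weight k V E A"
      unfolding half_edge_configs_def edge_weight_def signed_subset_sum_def
      using fV fE by (intro prod_sum_PiE[symmetric]) (auto simp: finite_incident)
    finally show ?thesis .
  qed
  have "2 ^ card E * int (card {g \<in> ?C. \<forall>e\<in>E. edge_sign g e = s}) =
      (\<Sum>g\<in>?C. \<Prod>e\<in>E. s * edge_sign g e + 1)"
    using fC by (simp add: ind sum.If_cases Int_def mult.commute)
  also have "\<dots> = (\<Sum>g\<in>?C. \<Sum>A\<in>Pow E. s ^ card A * (\<Prod>e\<in>A. edge_sign g e))"
    using fE by (simp add: prod_add prod.distrib)
  also have "\<dots> = (\<Sum>A\<in>Pow E. s ^ card A * (\<Sum>g\<in>?C. \<Prod>e\<in>A. edge_sign g e))"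
    by (subst sum.swap) (simp add: sum_distrib_left)
  also have "\<dots> = (\<Sum>A\<in>Pow E. s ^ card A * edge_weight k V E A)"
    by (intro sum.cong) (auto simp: sumA)
  finally show ?thesis .
qed

text \<open>By the handshake lemma the halved degrees sum to \<open>card A\<close>, so the global
  sign splits into the local signs \<open>(-1) ^ (degree A v div 2)\<close>, each making its factor
  positive.\<close>

lemma edge_weight_sign:
  assumes G: "simple_graph V E" and R: "regular (2 * k) V E" and A: "A \<subseteq> E"
    and ev: "\<forall>v\<in>V. even (degree A v)"
  shows "(-1) ^ card A * edge_weight k V E A > 0"
proof -
  have fE: "finite E"
    using simple_graph_finite_edges[OF G] .
  have "2 * (\<Sum>v\<in>V. degree A v div 2) = 2 * card A"
    using ev handshake[OF G A] by (simp add: sum_distrib_left)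
  then have "(-1) ^ card A * edge_weight k V E A =
      (\<Prod>v\<in>V. (-1) ^ (degree A v div 2) * signed_subset_sum (incident E v) (incident A v) k)"
    by (simp add: edge_weight_def prod.distrib flip: power_sum)
  also have "\<dots> > 0"
  proof (rule prod_pos)
    fix v assume "v \<in> V"
    then show "0 < (-1) ^ (degree A v div 2) * signed_subset_sum (incident E v) (incident A v) k"
      using signed_subset_sum_even[OF finite_incident[OF fE] incident_mono[OF A], of v k] R ev
      by (simp add: card_incident regular_def)
  qed
  finally show ?thesis .
qed

lemma edge_weight_eq_0:
  assumes G: "simple_graph V E" and R: "regular (2 * k) V E" and A: "A \<subseteq> E"
    and v: "v \<in> V" "odd (degree A v)"
  shows "edge_weight k V E A = 0"
proof -
  have "signed_subset_sum (incident E v) (incident A v) k = 0"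
    using simple_graph_finite_edges[OF G] A R v
    by (intro signed_subset_sum_odd incident_mono)
      (simp_all add: finite_incident card_incident regular_def)
  then show ?thesis
    using v(1) G unfolding edge_weight_def simple_graph_def by (intro prod_zero) auto
qed

section \<open>Bipartiteness and even subgraphs\<close>

lemma even_card_symdiff:
  assumes "finite A" "finite B"
  shows "even (card (sym_diff A B)) \<longleftrightarrow> (even (card A) \<longleftrightarrow> even (card B))"
proof -
  have "card (sym_diff A B) = card (A - B) + card (B - A)"
    using assms by (intro card_Un_disjoint) auto
  moreover have "card (A - B) + card (A \<inter> B) = card A" "card (B - A) + card (A \<inter> B) = card B"
    using card_Int_Diff[OF assms(1), of B] card_Int_Diff[OF assms(2), of A]
    by (simp_all add: Int_commute)
  moreover have "even (p + q) \<longleftrightarrow> (even (p + r) \<longleftrightarrow> even (q + r))" for p q r :: nat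
    by auto
  ultimately show ?thesis
    by metis
qed

lemma even_degree_symdiff:
  assumes "finite A" "finite B"
  shows "even (degree (sym_diff A B) v) \<longleftrightarrow> (even (degree A v) \<longleftrightarrow> even (degree B v))"
proof -
  have "incident (sym_diff A B) v = sym_diff (incident A v) (incident B v)"
    by (auto simp: incident_def)
  then show ?thesis
    using even_card_symdiff[of "incident A v" "incident B v"] assms
    by (simp add: finite_incident card_incident[symmetric])
qed

text \<open>Every edge has exactly one end in \<open>X\<close>, so \<open>card A\<close> is the sum
  of the even degrees over \<open>X\<close>.\<close>

lemma bipartite_even_subgraph:
  assumes G: "simple_graph V E" and bip: "bipartite V E" and A: "A \<subseteq> E"
    and ev: "\<forall>v\<in>V. even (degree A v)"
  shows "even (card A)"
proof -
  obtain X Y where XY: "X \<union> Y = V" "X \<inter> Y = {}" "\<forall>e\<in>E. \<exists>x\<in>X. \<exists>y\<in>Y. e = {x, y}"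
    using bip by (auto simp: bipartite_def)
  have fA: "finite A" and fX: "finite X"
    using simple_graph_finite_edges[OF G] A G XY(1) finite_subset by (auto simp: simple_graph_def)
  have "(\<Sum>x\<in>X. degree A x) = (\<Sum>x\<in>X. \<Sum>e\<in>{e \<in> A. x \<in> e}. 1)"
    by (simp add: degree_def)
  also have "\<dots> = (\<Sum>e\<in>A. \<Sum>x\<in>{x \<in> X. x \<in> e}. 1)"
    using fA fX by (intro sum.swap_restrict)
  also have "\<dots> = (\<Sum>e\<in>A. 1)"
  proof (rule sum.cong)
    fix e assume "e \<in> A"
    then obtain x y where xy: "x \<in> X" "y \<in> Y" "e = {x, y}"
      using XY(3) A by (meson subsetD)
    then have "y \<notin> X"
      using XY(2) by blast
    with xy(1) have "{x \<in> X. x \<in> e} = {x}"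
      unfolding xy(3) by blast
    then show "(\<Sum>x\<in>{x \<in> X. x \<in> e}. 1) = (1::nat)"
      by simp
  qed simp
  finally have "card A = (\<Sum>x\<in>X. degree A x)"
    by simp
  also have "even \<dots>"
    using ev XY(1) by (intro dvd_sum) auto
  finally show ?thesis .
qed

text \<open>These are the T-joins for \<open>T = {u, v}\<close>, or for empty \<open>T\<close> when
  \<open>u = v\<close>: the nested equivalence fails only at \<open>u\<close> and \<open>v\<close>,
  and nowhere if they coincide.\<close>

definition joins :: "'a set set \<Rightarrow> 'a \<Rightarrow> 'a \<Rightarrow> 'a set set set" where
  "joins E u v = {A. A \<subseteq> E \<and> (\<forall>w. even (degree A w) \<longleftrightarrow> (w = u \<longleftrightarrow> w = v))}"

text \<open>Degree parities add, so the odd contributions at \<open>v\<close> cancel, as in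
  concatenating walks.\<close>

lemma joins_symdiff:
  assumes "finite E" "A \<in> joins E u v" "B \<in> joins E v w"
  shows "sym_diff A B \<in> joins E u w"
proof -
  have "finite A" "finite B"
    using assms by (auto simp: joins_def intro: finite_subset)
  then show ?thesis
    using assms(2,3) unfolding joins_def by (auto simp: even_degree_symdiff)
qed

lemma joins_sym: "joins E u v = joins E v u"
  by (auto simp: joins_def)

lemma joins_edge:
  assumes "{u, v} \<in> E" "u \<noteq> v"
  shows "{{u, v}} \<in> joins E u v"
proof -
  have "degree {{u, v}} w = (if w = u \<or> w = v then 1 else 0)" for w
  proof -
    have "incident {{u, v}} w = (if w = u \<or> w = v then {{u, v}} else {})"
      by (auto simp: incident_def)
    then show ?thesis
      by (simp flip: card_incident)
  qed
  then show ?thesis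
    using assms by (auto simp: joins_def)
qed

text \<open>
  Joins serve as walks modulo 2: two vertices are connected iff they admit a join, and a vertex is
  coloured by the parity of a join to it from a chosen representative of its component.
\<close>

lemma bipartite_if_even_subgraphs_even:
  assumes G: "simple_graph V E"
    and even: "\<And>A. A \<subseteq> E \<Longrightarrow> \<forall>v\<in>V. even (degree A v) \<Longrightarrow> even (card A)"
  shows "bipartite V E"
proof -
  have fE: "finite E"
    using simple_graph_finite_edges[OF G] .
  define root where "root v = (SOME r. joins E r v \<noteq> {})" for v
  define J where "J v = (SOME A. A \<in> joins E (root v) v)" for v
  have "{} \<in> joins E v v" for v
    by (simp add: joins_def degree_def)
  then have "joins E (root v) v \<noteq> {}" for v
    unfolding root_def by (metis (mono_tags, lifting) empty_iff someI)
  then have J: "J v \<in> joins E (root v) v" for v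
    unfolding J_def by (metis ex_in_conv someI_ex)
  have fJ: "finite (J v)" for v
    using J[of v] fE by (auto simp: joins_def intro: finite_subset)
  \<comment> \<open>\<open>root\<close> depends only on which \<open>r\<close> admit a join to the
    vertex, and adding the edge shows that \<open>u\<close> and \<open>v\<close> admit the same
    ones.\<close>
  have root: "root u = root v" if e: "{u, v} \<in> E" "u \<noteq> v" for u v
  proof -
    have "joins E r u \<noteq> {} \<longleftrightarrow> joins E r v \<noteq> {}" for r
      using joins_symdiff[OF fE] joins_edge[OF e] joins_sym[of E u v] by blast
    then show ?thesis
      by (simp add: root_def)
  qed
  have parity: "even (card (J u)) \<longleftrightarrow> odd (card (J v))" if e: "{u, v} \<in> E" "u \<noteq> v" for u v
  proof -
    \<comment> \<open>Going from the root to \<open>u\<close>, across the edge and back from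
      \<open>v\<close> closes up modulo 2; the resulting even subgraph has size congruent to
      \<open>card (J u) + 1 + card (J v)\<close>.\<close>
    let ?P = "sym_diff (J u) {{u, v}}"
    have "?P \<in> joins E (root u) v"
      by (rule joins_symdiff[OF fE J joins_edge[OF e]])
    moreover have "J v \<in> joins E v (root u)"
      using J[of v] root[OF e] joins_sym by metis
    ultimately have "sym_diff ?P (J v) \<in> joins E (root u) (root u)"
      by (rule joins_symdiff[OF fE])
    then have "even (card (sym_diff ?P (J v)))"
      using even[of "sym_diff ?P (J v)"] by (simp add: joins_def)
    then show ?thesis
      using fJ by (simp add: even_card_symdiff) blast
  qed
  define X where "X = {v \<in> V. even (card (J v))}"
  define Y where "Y = {v \<in> V. odd (card (J v))}"
  have "\<exists>x\<in>X. \<exists>y\<in>Y. e = {x, y}" if e: "e \<in> E" for e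
  proof -
    obtain u v where uv: "e = {u, v}" "u \<noteq> v" "u \<in> V" "v \<in> V"
      using simple_graph_edgeE[OF G e] .
    then have "even (card (J u)) \<longleftrightarrow> odd (card (J v))"
      using parity e by blast
    then show ?thesis
      using uv by (cases "even (card (J u))") (auto simp: X_def Y_def insert_commute)
  qed
  moreover have "X \<union> Y = V" "X \<inter> Y = {}"
    by (auto simp: X_def Y_def)
  ultimately show ?thesis
    unfolding bipartite_def by blast
qed

section \<open>The comparison\<close>

theorem corollary1p5:
  fixes V :: "'a set" and E :: "'a set set" and k :: nat
  assumes "simple_graph V E"
    and "regular (2 * k) V E"
  shows "card (eulerian_orientations V E) \<ge> card (spanning_regular_subgraphs k V E) \<and>
    (card (eulerian_orientations V E) = card (spanning_regular_subgraphs k V E) \<longleftrightarrow>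
      bipartite V E)"
proof -
  let ?W = "edge_weight k V E"
  \<comment> \<open>The difference of the two expansions, term by term: positive if \<open>A\<close>
    has odd size and even degrees at all vertices, and zero for every other
    \<open>A \<subseteq> E\<close>.\<close>
  let ?t = "\<lambda>A. (-1) ^ card A * ?W A - ?W A"
  let ?N = "int (card (eulerian_orientations V E))"
  let ?M = "int (card (spanning_regular_subgraphs k V E))"
  have fE: "finite E"
    using simple_graph_finite_edges[OF assms(1)] .
  have "2 ^ card E * ?N = (\<Sum>A\<in>Pow E. (-1) ^ card A * ?W A)"
    using sum_edge_sign_expansion[OF assms(1), of "-1" k] card_eulerian_orientations[OF assms]
    by simp
  moreover have "2 ^ card E * ?M = (\<Sum>A\<in>Pow E. ?W A)"
    using sum_edge_sign_expansion[OF assms(1), of 1 k] card_spanning_regular_subgraphs[OF assms(1)]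
    by simp
  ultimately have diff: "2 ^ card E * (?N - ?M) = (\<Sum>A\<in>Pow E. ?t A)"
    by (simp add: sum_subtractf right_diff_distrib)
  have t_even: "?t A = 0" if "even (card A)" for A
    using that by simp
  have t_odd_deg: "?t A = 0" if "A \<subseteq> E" "\<not> (\<forall>v\<in>V. even (degree A v))" for A
    using edge_weight_eq_0[OF assms that(1)] that(2) by auto
  have t_pos: "?t A > 0" if "A \<subseteq> E" "\<forall>v\<in>V. even (degree A v)" "odd (card A)" for A
    using edge_weight_sign[OF assms that(1,2)] that(3) by simp
  have nonneg: "?t A \<ge> 0" if "A \<in> Pow E" for A
    using t_even[of A] t_odd_deg[of A] t_pos[of A] that by fastforce
  have "2 ^ card E * (?N - ?M) \<ge> 0"
    unfolding diff by (rule sum_nonneg) (rule nonneg)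
  then have le: "?M \<le> ?N"
    by (simp add: zero_le_mult_iff)
  have "?N = ?M \<longleftrightarrow> 2 ^ card E * (?N - ?M) = 0"
    by simp
  \<comment> \<open>No cancellation is possible among nonnegative terms, so equality forces each to
    vanish.\<close>
  also have "\<dots> \<longleftrightarrow> (\<forall>A\<in>Pow E. ?t A = 0)"
    unfolding diff using fE by (intro sum_nonneg_eq_0_iff nonneg) auto
  also have "\<dots> \<longleftrightarrow> (\<forall>A. A \<subseteq> E \<longrightarrow> (\<forall>v\<in>V. even (degree A v)) \<longrightarrow> even (card A))"
    using t_even t_odd_deg t_pos by (metis PowD PowI less_irrefl)
  also have "\<dots> \<longleftrightarrow> bipartite V E"
    using bipartite_even_subgraph[OF assms(1)] bipartite_if_even_subgraphs_even[OF assms(1)]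
    by blast
  finally show ?thesis
    using le by simp
qed

end
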